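(* Let $A$ and $B$ be two probability matrices such that the pair $(A,B)$ satisfies property $( *2\mathrm{C})$. If $E$ is a reflexive locally convex space, then every $A$-bounded operator $T$ on $E$ satisfying $$\lim_{n\to\infty}(T-\mathrm{Id})(AT)_n x=\lim_{n\to\infty}(AT)_n(T-\mathrm{Id})x=0\quad\text{for every }x\in E$$ is $B$-ergodic.
   Context: All locally convex spaces are Hausdorff and over $\mathbb{C}$; an operator on $E$ is a continuous linear map $E\to E$. A reflexive space is a barrelled, semi-reflexive locally convex Hausdorff space. Matrices are infinite complex matrices indexed by $\mathbb{N}_0=\{0,1,2,\dots\}$; $A=(a_{nk})$ is lower triangular if $a_{nk}=0$ whenever $k>n$. A probability matrix is a lower triangular matrix with $a_{nk}\ge 0$ for all $n,k$ and $\sum_{i=0}^n a_{ni}=1$ for every $n$. For a lower triangular matrix $A$ and an operator $T$ on $E$ put $(AT)_n=\sum_{i=0}^n a_{ni}T^i$, with $T^0=\mathrm{Id}$. $T$ is $A$-bounded if for every continuous seminorm $p$ on $E$ there is a continuous seminorm $q$ on $E$ with $p((AT)_n x)\le q(x)$ for all $x\in E$, $n\in\mathbb{N}_0$. $T$ is $A$-ergodic if there is an operator $P$ on $E$ with $(AT)_n x\to Px$ for every $x\in E$. For lower triangular matrices $A,B$: the pair $(A,B)$ satisfies $( *2\mathrm{C})$ if there is a lower triangular matrix $C=(c_{ni})$ with $CA=B$, $\sup_n\sum_{i=0}^\infty|c_{ni}|<\infty$ and $\lim_n c_{ni}=0$ for each fixed $i\in\mathbb{N}_0$. *)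

theory Defs
  imports "HOL-Analysis.Analysis"
begin

section \<open>Infinite complex matrices\<close>

definition lower_triangular :: "(nat \<Rightarrow> nat \<Rightarrow> complex) \<Rightarrow> bool" where
  "lower_triangular A \<longleftrightarrow> (\<forall>n k. n < k \<longrightarrow> A n k = 0)"

definition probability_matrix :: "(nat \<Rightarrow> nat \<Rightarrow> complex) \<Rightarrow> bool" where
  "probability_matrix A \<longleftrightarrow>
     lower_triangular A \<and> (\<forall>n k. A n k \<in> \<real>\<^sub>\<ge>\<^sub>0) \<and> (\<forall>n. (\<Sum>i\<le>n. A n i) = 1)"

text \<open>The series is a finite sum whenever the left factor is lower triangular.\<close>

definition matrix_product ::
  "(nat \<Rightarrow> nat \<Rightarrow> complex) \<Rightarrow> (nat \<Rightarrow> nat \<Rightarrow> complex) \<Rightarrow> nat \<Rightarrow> nat \<Rightarrow> complex" where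
  "matrix_product C A = (\<lambda>n k. \<Sum>i. C n i * A i k)"

text \<open>Property (*2C) of a pair of matrices. The rows of a lower triangular matrix are finitely
  supported, so the series in the second condition always converges.\<close>

definition star_2C :: "(nat \<Rightarrow> nat \<Rightarrow> complex) \<Rightarrow> (nat \<Rightarrow> nat \<Rightarrow> complex) \<Rightarrow> bool" where
  "star_2C A B \<longleftrightarrow>
     (\<exists>C. lower_triangular C \<and> matrix_product C A = B
        \<and> bdd_above (range (\<lambda>n. \<Sum>i. norm (C n i)))
        \<and> (\<forall>i. (\<lambda>n. C n i) \<longlonglongrightarrow> 0))"

section \<open>Complex locally convex Hausdorff spaces\<close>

text \<open>The space is a whole type. Its additive group and its Hausdorff group topology come from type
  classes, while the scalar multiplication is a locale parameter.\<close>

locale locally_convex_space = vector_space scale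
  for scale :: "complex \<Rightarrow> 'a::{topological_ab_group_add, t2_space} \<Rightarrow> 'a" +
  assumes continuous_scale: "continuous_on UNIV (\<lambda>(c, x). scale c x)"
    and locally_convex:
      "\<And>U. open U \<Longrightarrow> 0 \<in> U \<Longrightarrow>
         \<exists>V. open V \<and> 0 \<in> V \<and> V \<subseteq> U \<and>
           (\<forall>x\<in>V. \<forall>y\<in>V. \<forall>s t :: real. 0 \<le> s \<and> 0 \<le> t \<and> s + t = 1 \<longrightarrow>
              scale (of_real s) x + scale (of_real t) y \<in> V)"
begin

definition continuous_seminorm :: "('a \<Rightarrow> real) \<Rightarrow> bool" where
  "continuous_seminorm p \<longleftrightarrow>
     (\<forall>x. 0 \<le> p x) \<and> (\<forall>x y. p (x + y) \<le> p x + p y) \<and> (\<forall>c x. p (scale c x) = norm c * p x)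
     \<and> continuous_on UNIV p"

definition operator :: "('a \<Rightarrow> 'a) \<Rightarrow> bool" where
  "operator T \<longleftrightarrow> Vector_Spaces.linear scale scale T \<and> continuous_on UNIV T"

subsection \<open>Barrelled spaces\<close>

definition absolutely_convex :: "'a set \<Rightarrow> bool" where
  "absolutely_convex S \<longleftrightarrow>
     (\<forall>x\<in>S. \<forall>y\<in>S. \<forall>c d. norm c + norm d \<le> 1 \<longrightarrow> scale c x + scale d y \<in> S)"

definition absorbing :: "'a set \<Rightarrow> bool" where
  "absorbing S \<longleftrightarrow> (\<forall>x. \<exists>r>0. \<forall>c. norm c \<le> r \<longrightarrow> scale c x \<in> S)"

definition barrel :: "'a set \<Rightarrow> bool" where
  "barrel S \<longleftrightarrow> closed S \<and> absolutely_convex S \<and> absorbing S"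

definition barrelled :: bool where
  "barrelled \<longleftrightarrow> (\<forall>S. barrel S \<longrightarrow> 0 \<in> interior S)"

subsection \<open>Semi-reflexive and reflexive spaces\<close>

definition bounded_set :: "'a set \<Rightarrow> bool" where
  "bounded_set S \<longleftrightarrow>
     (\<forall>U. open U \<and> 0 \<in> U \<longrightarrow> (\<exists>r>0. \<forall>c. r \<le> norm c \<longrightarrow> S \<subseteq> scale c ` U))"

definition dual :: "('a \<Rightarrow> complex) set" where
  "dual = {f. Vector_Spaces.linear scale (*) f \<and> continuous_on UNIV f}"

text \<open>The strong topology on the dual, that is, uniform convergence on bounded sets.\<close>

definition strong_nbhd :: "('a \<Rightarrow> complex) \<Rightarrow> 'a set \<Rightarrow> real \<Rightarrow> ('a \<Rightarrow> complex) set" where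
  "strong_nbhd f S e = {g \<in> dual. \<forall>x\<in>S. norm (g x - f x) \<le> e}"

definition strong_open :: "('a \<Rightarrow> complex) set \<Rightarrow> bool" where
  "strong_open W \<longleftrightarrow>
     W \<subseteq> dual \<and> (\<forall>f\<in>W. \<exists>S e. bounded_set S \<and> 0 < e \<and> strong_nbhd f S e \<subseteq> W)"

definition strong_topology :: "('a \<Rightarrow> complex) topology" where
  "strong_topology = topology strong_open"

text \<open>Elements of the strong bidual are functions on all of \<^typ>\<open>'a \<Rightarrow> complex\<close>;
  only their restrictions to \<^const>\<open>dual\<close> matter.\<close>

definition strong_bidual :: "(('a \<Rightarrow> complex) \<Rightarrow> complex) set" where
  "strong_bidual =
     {u. (\<forall>f\<in>dual. \<forall>g\<in>dual. u (\<lambda>x. f x + g x) = u f + u g)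
       \<and> (\<forall>c. \<forall>f\<in>dual. u (\<lambda>x. c * f x) = c * u f)
       \<and> continuous_map strong_topology euclidean u}"

text \<open>The canonical map into the strong bidual is onto.\<close>

definition semi_reflexive :: bool where
  "semi_reflexive \<longleftrightarrow> (\<forall>u\<in>strong_bidual. \<exists>x. \<forall>f\<in>dual. u f = f x)"

definition reflexive :: bool where
  "reflexive \<longleftrightarrow> barrelled \<and> semi_reflexive"

subsection \<open>Matrix means of an operator\<close>

definition mean :: "(nat \<Rightarrow> nat \<Rightarrow> complex) \<Rightarrow> ('a \<Rightarrow> 'a) \<Rightarrow> nat \<Rightarrow> 'a \<Rightarrow> 'a" where
  "mean A T n x = (\<Sum>i\<le>n. scale (A n i) ((T ^^ i) x))"

definition matrix_bounded :: "(nat \<Rightarrow> nat \<Rightarrow> complex) \<Rightarrow> ('a \<Rightarrow> 'a) \<Rightarrow> bool" where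
  "matrix_bounded A T \<longleftrightarrow>
     (\<forall>p. continuous_seminorm p \<longrightarrow>
        (\<exists>q. continuous_seminorm q \<and> (\<forall>x n. p (mean A T n x) \<le> q x)))"

definition matrix_ergodic :: "(nat \<Rightarrow> nat \<Rightarrow> complex) \<Rightarrow> ('a \<Rightarrow> 'a) \<Rightarrow> bool" where
  "matrix_ergodic A T \<longleftrightarrow> (\<exists>P. operator P \<and> (\<forall>x. (\<lambda>n. mean A T n x) \<longlonglongrightarrow> P x))"

lemma bounded_set_Un:
  assumes "bounded_set S" "bounded_set S'"
  shows "bounded_set (S \<union> S')"
  unfolding bounded_set_def
proof (intro allI impI)
  fix U :: "'a set"
  assume "open U \<and> 0 \<in> U"
  then obtain r r' where "r > 0" "\<forall>c. r \<le> norm c \<longrightarrow> S \<subseteq> scale c ` U"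
    and "r' > 0" "\<forall>c. r' \<le> norm c \<longrightarrow> S' \<subseteq> scale c ` U"
    using assms unfolding bounded_set_def by metis
  then show "\<exists>r>0. \<forall>c. r \<le> norm c \<longrightarrow> S \<union> S' \<subseteq> scale c ` U"
    by (intro exI[of _ "max r r'"]) auto
qed

lemma istopology_strong_open: "istopology strong_open"
  unfolding istopology_def
proof (intro conjI allI impI)
  fix V W
  assume V: "strong_open V" and W: "strong_open W"
  show "strong_open (V \<inter> W)"
    unfolding strong_open_def
  proof (intro conjI ballI)
    show "V \<inter> W \<subseteq> dual"
      using V by (auto simp: strong_open_def)
    fix f
    assume "f \<in> V \<inter> W"
    then obtain S e S' e' where
        "bounded_set S" "0 < e" "strong_nbhd f S e \<subseteq> V"
        "bounded_set S'" "0 < e'" "strong_nbhd f S' e' \<subseteq> W"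
      using V W unfolding strong_open_def by (metis IntE)
    moreover have "strong_nbhd f (S \<union> S') (min e e') \<subseteq> strong_nbhd f S e \<inter> strong_nbhd f S' e'"
      by (auto simp: strong_nbhd_def)
    ultimately show "\<exists>S e. bounded_set S \<and> 0 < e \<and> strong_nbhd f S e \<subseteq> V \<inter> W"
      by (intro exI[of _ "S \<union> S'"] exI[of _ "min e e'"]) (auto intro: bounded_set_Un)
  qed
next
  fix K
  assume "\<forall>W\<in>K. strong_open W"
  then show "strong_open (\<Union>K)"
    unfolding strong_open_def by (meson Sup_le_iff Union_iff Sup_upper order_trans)
qed

lemma openin_strong_topology: "openin strong_topology W \<longleftrightarrow> strong_open W"
  by (simp add: strong_topology_def istopology_strong_open)

end

end

theory Submission
  imports Defs
begin

text \<open>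
  Write \<open>M n\<close> for the \<open>A\<close>-means of \<open>T\<close>. The proof shows that \<open>M n x\<close> itself converges for every \<open>x\<close>; the
  matrix \<open>C\<close> with \<open>C A = B\<close> then carries the convergence over to the \<open>B\<close>-means by Toeplitz' theorem,
  because these are the \<open>C\<close>-means of the sequence \<open>M n x\<close> and the rows of \<open>C\<close> sum to one.

  The convergence of \<open>M n x\<close> is the mean ergodic theorem (\<open>mean_ergodic\<close>). The sequence \<open>M n x\<close> is
  bounded, so semi-reflexivity gives it a weak cluster point \<open>z\<close> (\<open>weak_cluster_point\<close>). As
  \<open>(T - id) M n x\<close> tends to zero, \<open>z\<close> is a fixed point of \<open>T\<close>, and so of each \<open>M n\<close>. A continuous
  functional that vanishes on the range of \<open>T - id\<close> is invariant under \<open>T\<close>, so it takes the same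
  value at \<open>x\<close>, at every \<open>M n x\<close> and at \<open>z\<close>; by the Hahn-Banach theorem \<open>x - z\<close> lies in the closure
  of that range. On the range the means tend to zero by hypothesis, and on its closure they do so by
  equicontinuity, which is the \<open>A\<close>-boundedness of \<open>T\<close>. Hence \<open>M n x - z = M n (x - z)\<close> tends to zero.

  Two tools of locally convex analysis carry this argument. The Hahn-Banach theorem is derived in
  the form of Mazur and Orlicz (\<open>mazur_orlicz\<close>), which allows a separation from a subspace to be
  stated as a cone of linear constraints (\<open>hahn_banach_separation\<close>). The Minkowski functionals show
  that the continuous seminorms generate the topology (\<open>tendsto_iff_seminorms\<close>), so that all limits
  can be computed with seminorms.
\<close>

section \<open>The Hahn-Banach theorem in the form of Mazur and Orlicz\<close>

locale real_linear_space = vector_space scale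
  for scale :: "real \<Rightarrow> 'a::ab_group_add \<Rightarrow> 'a"
begin

definition sublinear :: "('a \<Rightarrow> real) \<Rightarrow> bool" where
  "sublinear q \<longleftrightarrow> (\<forall>x y. q (x + y) \<le> q x + q y) \<and> (\<forall>t\<ge>0. \<forall>x. q (scale t x) = t * q x)"

lemma sublinear_add: "sublinear q \<Longrightarrow> q (x + y) \<le> q x + q y"
  and sublinear_scale: "sublinear q \<Longrightarrow> 0 \<le> t \<Longrightarrow> q (scale t x) = t * q x"
  by (auto simp: sublinear_def)

lemma sublinear_zero: "sublinear q \<Longrightarrow> q 0 = 0"
  using sublinear_scale[of q 0 0] by simp

lemma sublinear_ge_minus: "sublinear q \<Longrightarrow> - q (- x) \<le> q x"
  using sublinear_add[of q x "- x"] by (simp add: sublinear_zero)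

text \<open>One inequality in the homogeneity suffices: the other one is the same inequality for the
  factor \<open>1 / t\<close>.\<close>

lemma sublinearI:
  assumes add: "\<And>x y. q (x + y) \<le> q x + q y"
    and scale: "\<And>t x. 0 < t \<Longrightarrow> q (scale t x) \<le> t * q x"
  shows "sublinear q"
  unfolding sublinear_def
proof (intro conjI allI impI add)
  fix t :: real and x
  assume "0 \<le> t"
  show "q (scale t x) = t * q x"
  proof (cases "t = 0")
    case True
    \<comment> \<open>The factors 2 and 1/2 show that \<open>q 0\<close> is neither negative nor positive.\<close>
    have "q 0 \<le> 2 * q 0" "q 0 \<le> 1/2 * q 0"
      using scale[of 2 0] scale[of "1/2" 0] by simp_all
    then show ?thesis
      using True by simp
  next
    case False
    with \<open>0 \<le> t\<close> have t: "0 < t"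
      by simp
    have "q x \<le> 1/t * q (scale t x)"
      using scale[of "1/t" "scale t x"] t by simp
    then show ?thesis
      using scale[OF t, of x] t by (simp add: field_simps)
  qed
qed

text \<open>A convex cone of pairs \<open>(k, r)\<close>, each of them standing for the constraint \<open>r \<le> g k\<close> on a
  functional \<open>g\<close>.\<close>

definition constraint_cone :: "('a \<times> real) set \<Rightarrow> bool" where
  "constraint_cone K \<longleftrightarrow> K \<noteq> {}
     \<and> (\<forall>(k, r)\<in>K. \<forall>(k', r')\<in>K. (k + k', r + r') \<in> K)
     \<and> (\<forall>(k, r)\<in>K. \<forall>t\<ge>0. (scale t k, t * r) \<in> K)"

lemma constraint_coneI:
  assumes "K \<noteq> {}"
    and "\<And>k r k' r'. (k, r) \<in> K \<Longrightarrow> (k', r') \<in> K \<Longrightarrow> (k + k', r + r') \<in> K"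
    and "\<And>k r t. (k, r) \<in> K \<Longrightarrow> 0 \<le> t \<Longrightarrow> (scale t k, t * r) \<in> K"
  shows "constraint_cone K"
  unfolding constraint_cone_def using assms by blast

text \<open>For linear \<open>g\<close>, lying below this functional means lying below \<open>q\<close> and respecting all constraints
  in \<open>K\<close>: \<open>g (x + k) \<le> q (x + k)\<close> and \<open>r \<le> g k\<close> add up to \<open>g x \<le> q (x + k) - r\<close>, and conversely
  \<open>x = - k\<close> gives back \<open>r \<le> g k\<close>.\<close>

definition tighten :: "('a \<Rightarrow> real) \<Rightarrow> ('a \<times> real) set \<Rightarrow> 'a \<Rightarrow> real" where
  "tighten q K x = (INF (k, r)\<in>K. q (x + k) - r)"

context
  fixes q K
  assumes q: "sublinear q" and K: "constraint_cone K"
    and below: "\<And>k r. (k, r) \<in> K \<Longrightarrow> r \<le> q k"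
begin

lemma tighten_bdd_below: "bdd_below ((\<lambda>(k, r). q (x + k) - r) ` K)"
proof (rule bdd_belowI2, clarify)
  fix k r
  assume "(k, r) \<in> K"
  then have "r \<le> q k"
    by (rule below)
  moreover have "q k \<le> q (x + k) + q (- x)"
    using sublinear_add[OF q, of "x + k" "- x"] by simp
  ultimately show "- q (- x) \<le> q (x + k) - r"
    by simp
qed

lemma tighten_le: "(k, r) \<in> K \<Longrightarrow> tighten q K x \<le> q (x + k) - r"
  unfolding tighten_def using cINF_lower[OF tighten_bdd_below, of "(k, r)" x] by simp

lemma tighten_greatest:
  "(\<And>k r. (k, r) \<in> K \<Longrightarrow> c \<le> q (x + k) - r) \<Longrightarrow> c \<le> tighten q K x"
  unfolding tighten_def using K by (intro cINF_greatest) (auto simp: constraint_cone_def)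

lemma tighten_le_self: "tighten q K x \<le> q x"
proof -
  obtain k r where kr: "(k, r) \<in> K"
    using K by (auto simp: constraint_cone_def)
  then have "(scale 0 k, 0 * r) \<in> K"
    using K unfolding constraint_cone_def by blast
  then show ?thesis
    using tighten_le[of 0 0 x] by simp
qed

lemma sublinear_tighten: "sublinear (tighten q K)"
proof (rule sublinearI)
  fix x y
  have "tighten q K (x + y) - tighten q K x \<le> tighten q K y"
  proof (rule tighten_greatest)
    fix k' r'
    assume 2: "(k', r') \<in> K"
    have "tighten q K (x + y) - (q (y + k') - r') \<le> tighten q K x"
    proof (rule tighten_greatest)
      fix k r
      assume 1: "(k, r) \<in> K"
      have "(k + k', r + r') \<in> K"
        using K 1 2 unfolding constraint_cone_def by blast
      from tighten_le[OF this, of "x + y"]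
      have "tighten q K (x + y) \<le> q ((x + k) + (y + k')) - (r + r')"
        by (simp add: algebra_simps)
      then show "tighten q K (x + y) - (q (y + k') - r') \<le> q (x + k) - r"
        using sublinear_add[OF q, of "x + k" "y + k'"] by simp
    qed
    then show "tighten q K (x + y) - tighten q K x \<le> q (y + k') - r'"
      by simp
  qed
  then show "tighten q K (x + y) \<le> tighten q K x + tighten q K y"
    by simp
next
  fix t :: real and x
  assume t: "0 < t"
  have "tighten q K (scale t x) / t \<le> tighten q K x"
  proof (rule tighten_greatest)
    fix k r
    assume "(k, r) \<in> K"
    then have "(scale t k, t * r) \<in> K"
      using K t unfolding constraint_cone_def by (auto dest!: bspec)
    from tighten_le[OF this, of "scale t x"]
    have "tighten q K (scale t x) \<le> q (scale t (x + k)) - t * r"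
      by (simp add: scale_right_distrib)
    also have "\<dots> = t * (q (x + k) - r)"
      using sublinear_scale[OF q, of t "x + k"] t by (simp add: right_diff_distrib)
    finally show "tighten q K (scale t x) / t \<le> q (x + k) - r"
      using t by (simp add: field_simps)
  qed
  then show "tighten q K (scale t x) \<le> t * tighten q K x"
    using t by (simp add: field_simps)
qed

end

text \<open>Below every sublinear functional there is a minimal one, because a chain of sublinear
  functionals below \<open>q\<close> is bounded from below by \<open>\<lambda>x. - q (- x)\<close> and its pointwise infimum is
  sublinear again.\<close>

lemma minimal_sublinear:
  assumes q: "sublinear q"
  obtains h where "sublinear h" "\<And>x. h x \<le> q x"
    "\<And>h'. sublinear h' \<Longrightarrow> (\<And>x. h' x \<le> h x) \<Longrightarrow> h' = h"
proof -
  define S where "S = {h. sublinear h \<and> h \<le> q}"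
  define R :: "('a \<Rightarrow> real) \<Rightarrow> ('a \<Rightarrow> real) \<Rightarrow> bool" where "R f g \<longleftrightarrow> g \<le> f" for f g
  have "\<exists>m\<in>S. \<forall>a\<in>S. R m a \<longrightarrow> a = m"
  proof (rule predicate_Zorn)
    show "partial_order_on S (relation_of R S)"
      by (rule partial_order_on_relation_ofI) (auto simp: R_def)
  next
    fix C
    assume C: "C \<in> Chains (relation_of R S)"
    then have CS: "C \<subseteq> S" and comp: "\<And>g h. g \<in> C \<Longrightarrow> h \<in> C \<Longrightarrow> g \<le> h \<or> h \<le> g"
      by (auto simp: Chains_def relation_of_def R_def)
    show "\<exists>u\<in>S. \<forall>a\<in>C. R a u"
    proof (cases "C = {}")
      case True
      then show ?thesis
        using q by (auto simp: S_def)
    next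
      case False
      define u where "u x = (INF h\<in>C. h x)" for x
      have bdd: "bdd_below ((\<lambda>h. h x) ` C)" for x
      proof (rule bdd_belowI2)
        fix h
        assume "h \<in> C"
        then have "sublinear h" "h (- x) \<le> q (- x)"
          using CS by (auto simp: S_def le_fun_def)
        then show "- q (- x) \<le> h x"
          using sublinear_ge_minus[of h x] by simp
      qed
      have le: "u x \<le> h x" if "h \<in> C" for h x
        unfolding u_def by (rule cINF_lower[OF bdd that])
      have greatest: "c \<le> u x" if "\<And>h. h \<in> C \<Longrightarrow> c \<le> h x" for c x
        unfolding u_def using False that by (intro cINF_greatest) auto
      have "sublinear u"
      proof (rule sublinearI)
        fix x y
        have "u (x + y) - u x \<le> u y"
        proof (rule greatest)
          fix h
          assume h: "h \<in> C"
          have "u (x + y) - h y \<le> u x"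
          proof (rule greatest)
            fix g
            assume g: "g \<in> C"
            obtain m where m: "m \<in> C" "m \<le> g" "m \<le> h"
              using comp[OF g h] g h by auto
            have "u (x + y) \<le> m (x + y)"
              by (rule le[OF m(1)])
            also have "\<dots> \<le> m x + m y"
              using m(1) CS by (intro sublinear_add) (auto simp: S_def)
            also have "\<dots> \<le> g x + h y"
              using m(2,3) by (intro add_mono) (auto simp: le_fun_def)
            finally show "u (x + y) - h y \<le> g x"
              by simp
          qed
          then show "u (x + y) - u x \<le> h y"
            by simp
        qed
        then show "u (x + y) \<le> u x + u y"
          by simp
      next
        fix t :: real and x
        assume t: "0 < t"
        have "u (scale t x) / t \<le> u x"
        proof (rule greatest)
          fix h
          assume h: "h \<in> C"
          have "u (scale t x) \<le> h (scale t x)"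
            by (rule le[OF h])
          also have "\<dots> = t * h x"
            using h CS t by (intro sublinear_scale) (auto simp: S_def)
          finally show "u (scale t x) / t \<le> h x"
            using t by (simp add: field_simps)
        qed
        then show "u (scale t x) \<le> t * u x"
          using t by (simp add: field_simps)
      qed
      moreover have "u \<le> q"
      proof -
        obtain h where "h \<in> C"
          using False by blast
        moreover from this have "h \<le> q"
          using CS by (auto simp: S_def)
        ultimately show ?thesis
          using le by (meson le_funI le_funD order_trans)
      qed
      ultimately show ?thesis
        using le by (auto simp: S_def R_def le_fun_def intro!: bexI[of _ u])
    qed
  qed
  then obtain m where "m \<in> S" and min: "\<And>a. a \<in> S \<Longrightarrow> a \<le> m \<Longrightarrow> a = m"
    by (auto simp: R_def)
  then have m: "sublinear m" "m \<le> q"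
    by (auto simp: S_def)
  show thesis
  proof (rule that[of m])
    fix h'
    assume "sublinear h'" "\<And>x. h' x \<le> m x"
    then show "h' = m"
      using m by (intro min) (auto simp: S_def le_fun_def intro: order_trans)
  qed (use m in \<open>auto simp: le_fun_def\<close>)
qed

text \<open>A minimal sublinear functional \<open>h\<close> is linear: tightening it by the ray of the constraints
  \<open>t * h y \<le> g (t y)\<close> yields a sublinear functional below \<open>h\<close>, hence \<open>h\<close> itself, and this says
  that \<open>h x \<le> h (x + y) - h y\<close>. So a functional that respects all constraints in \<open>K\<close> arises
  by first tightening \<open>q\<close> by \<open>K\<close> and then passing to a minimal sublinear functional.\<close>

theorem mazur_orlicz:
  assumes q: "sublinear q" and K: "constraint_cone K"
    and below: "\<And>k r. (k, r) \<in> K \<Longrightarrow> r \<le> q k"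
  obtains g where "\<And>x y. g (x + y) = g x + g y" "\<And>t x. g (scale t x) = t * g x"
    "\<And>x. g x \<le> q x" "\<And>k r. (k, r) \<in> K \<Longrightarrow> r \<le> g k"
proof -
  obtain h where h: "sublinear h" and h_le: "\<And>x. h x \<le> tighten q K x"
    and min: "\<And>h'. sublinear h' \<Longrightarrow> (\<And>x. h' x \<le> h x) \<Longrightarrow> h' = h"
    using minimal_sublinear[OF sublinear_tighten[OF q K below]] by metis
  have add: "h (x + y) = h x + h y" for x y
  proof -
    define ray where "ray = {(scale t y, t * h y) | t. 0 \<le> t}"
    have ray_iff: "(k, r) \<in> ray \<longleftrightarrow> (\<exists>t\<ge>0. k = scale t y \<and> r = t * h y)" for k r
      by (auto simp: ray_def)
    have cone: "constraint_cone ray"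
    proof (rule constraint_coneI)
      show "ray \<noteq> {}"
        by (auto simp: ray_def)
    next
      fix k r k' r'
      assume "(k, r) \<in> ray" "(k', r') \<in> ray"
      then obtain s t where "0 \<le> s" "0 \<le> t" "k = scale s y" "r = s * h y"
        "k' = scale t y" "r' = t * h y"
        unfolding ray_iff by blast
      then show "(k + k', r + r') \<in> ray"
        unfolding ray_iff by (intro exI[of _ "s + t"]) (simp add: scale_left_distrib distrib_right)
    next
      fix k r and t :: real
      assume "(k, r) \<in> ray" "0 \<le> t"
      then obtain s where "0 \<le> s" "k = scale s y" "r = s * h y"
        unfolding ray_iff by blast
      then show "(scale t k, t * r) \<in> ray"
        unfolding ray_iff using \<open>0 \<le> t\<close> by (intro exI[of _ "t * s"]) simp
    qed
    have le: "r \<le> h k" if "(k, r) \<in> ray" for k r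
      using that sublinear_scale[OF h] by (auto simp: ray_iff)
    have "tighten h ray = h"
      by (intro min sublinear_tighten tighten_le_self h cone le)
    moreover have "(y, h y) \<in> ray"
      unfolding ray_iff by (intro exI[of _ 1]) simp
    ultimately have "h x \<le> h (x + y) - h y"
      using tighten_le[OF h cone le, of y "h y" x] by simp
    then show ?thesis
      using sublinear_add[OF h, of x y] by simp
  qed
  have minus: "h (- x) = - h x" for x
    using add[of x "- x"] sublinear_zero[OF h] by simp
  show thesis
  proof (rule that[of h])
    fix t x
    show "h (scale t x) = t * h x"
    proof (cases "0 \<le> t")
      case True
      then show ?thesis
        by (rule sublinear_scale[OF h])
    next
      case False
      then have "h (scale (- t) x) = - t * h x"
        by (intro sublinear_scale[OF h]) simp
      then show ?thesis
        by (simp add: scale_minus_left minus)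
    qed
  next
    fix x
    show "h x \<le> q x"
      using h_le[of x] tighten_le_self[OF q K below, of x] by simp
  next
    fix k r
    assume kr: "(k, r) \<in> K"
    have "tighten q K (- k) \<le> q (- k + k) - r"
      using q K below kr by (rule tighten_le)
    then show "r \<le> h k"
      using h_le[of "- k"] by (simp add: minus sublinear_zero[OF q])
  qed (rule add)
qed

end

section \<open>Continuous seminorms and continuous functionals\<close>

context locally_convex_space
begin

lemma
  assumes "continuous_seminorm p"
  shows seminorm_nonneg: "0 \<le> p x"
    and seminorm_add: "p (x + y) \<le> p x + p y"
    and seminorm_scale: "p (scale c x) = norm c * p x"
    and seminorm_continuous: "continuous_on UNIV p"
  using assms by (auto simp: continuous_seminorm_def)

lemma seminorm_zero: "continuous_seminorm p \<Longrightarrow> p 0 = 0"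
  using seminorm_scale[of p 0 0] by simp

lemma seminorm_minus: "continuous_seminorm p \<Longrightarrow> p (- x) = p x"
  using seminorm_scale[of p "-1" x] by simp

lemma seminorm_sum:
  assumes "continuous_seminorm p"
  shows "p (\<Sum>i\<in>I. f i) \<le> (\<Sum>i\<in>I. p (f i))"
proof (induction I rule: infinite_finite_induct)
  case (insert i I)
  then show ?case
    using seminorm_add[OF assms, of "f i" "sum f I"] by simp
qed (simp_all add: seminorm_zero[OF assms])

lemma seminorm_tendsto_zero:
  assumes p: "continuous_seminorm p" and f: "(f \<longlongrightarrow> 0) F"
  shows "((\<lambda>n. p (f n)) \<longlongrightarrow> 0) F"
proof -
  have "isCont p 0"
    using seminorm_continuous[OF p] by (simp add: continuous_on_eq_continuous_at)
  then show ?thesis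
    using isCont_tendsto_compose[of 0 p f F] f seminorm_zero[OF p] by simp
qed

lemma continuous_if_diff_le:
  fixes f q :: "'a \<Rightarrow> real"
  assumes diff: "\<And>x y. \<bar>f x - f y\<bar> \<le> q (x - y)" and q: "(q \<longlongrightarrow> 0) (nhds 0)"
  shows "continuous_on UNIV f"
  unfolding continuous_on_eq_continuous_at[OF open_UNIV]
proof
  fix x :: 'a
  have "((\<lambda>y. y - x) \<longlongrightarrow> x - x) (at x)"
    by (intro tendsto_intros)
  then have "((\<lambda>y. q (y - x)) \<longlongrightarrow> 0) (at x)"
    by (intro filterlim_compose[OF q]) simp
  then have "((\<lambda>y. f y - f x) \<longlongrightarrow> 0) (at x)"
    by (rule Lim_null_comparison[rotated]) (simp add: diff)
  then show "isCont f x"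
    unfolding isCont_def by (rule LIM_zero_cancel)
qed

lemma tendsto_scale:
  assumes "(f \<longlongrightarrow> c) F" "(g \<longlongrightarrow> x) F"
  shows "((\<lambda>n. scale (f n) (g n)) \<longlongrightarrow> scale c x) F"
proof -
  have "isCont (\<lambda>(c, x). scale c x) (c, x)"
    using continuous_scale by (simp add: continuous_on_eq_continuous_at)
  from isCont_tendsto_compose[OF this tendsto_Pair[OF assms]] show ?thesis
    by simp
qed

definition minkowski :: "'a set \<Rightarrow> 'a \<Rightarrow> real" where
  "minkowski S x = Inf {t. 0 < t \<and> scale (of_real (1 / t)) x \<in> S}"

context
  fixes S V
  assumes S: "absolutely_convex S" and V: "open V" "0 \<in> V" "V \<subseteq> S"
begin

lemma absolutely_convex_combination:
  "x \<in> S \<Longrightarrow> y \<in> S \<Longrightarrow> norm c + norm d \<le> 1 \<Longrightarrow> scale c x + scale d y \<in> S"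
  using S by (auto simp: absolutely_convex_def)

lemma absolutely_convex_scale: "x \<in> S \<Longrightarrow> norm c \<le> 1 \<Longrightarrow> scale c x \<in> S"
  using absolutely_convex_combination[of x x c 0] by simp

lemma minkowski_le: "0 < t \<Longrightarrow> scale (of_real (1 / t)) x \<in> S \<Longrightarrow> minkowski S x \<le> t"
  unfolding minkowski_def by (intro cInf_lower) (auto intro!: bdd_belowI[of _ 0])

lemma minkowski_set_nonempty: "\<exists>t>0. scale (of_real (1 / t)) x \<in> S"
proof -
  have "((\<lambda>n. scale (of_real (1 / real (Suc n))) x) \<longlongrightarrow> scale (of_real 0) x) sequentially"
    using LIMSEQ_inverse_real_of_nat
    by (intro tendsto_scale tendsto_of_real tendsto_const) (simp add: inverse_eq_divide)
  then have "\<forall>\<^sub>F n in sequentially. scale (of_real (1 / real (Suc n))) x \<in> V"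
    using V by (intro topological_tendstoD[of _ 0]) simp_all
  then obtain n where "scale (of_real (1 / real (Suc n))) x \<in> V"
    by (auto simp: eventually_sequentially)
  then show ?thesis
    using V(3) by (intro exI[of _ "real (Suc n)"]) auto
qed

lemma minkowski_greatest:
  "(\<And>t. 0 < t \<Longrightarrow> scale (of_real (1 / t)) x \<in> S \<Longrightarrow> c \<le> t) \<Longrightarrow> c \<le> minkowski S x"
  unfolding minkowski_def using minkowski_set_nonempty[of x] by (intro cInf_greatest) auto

lemma minkowski_less_one: "minkowski S x < 1 \<Longrightarrow> x \<in> S"
proof -
  assume "minkowski S x < 1"
  then have "\<not> 1 \<le> minkowski S x"
    by simp
  then obtain t where t: "0 < t" "t < 1" and x: "scale (of_real (1 / t)) x \<in> S"
    using minkowski_greatest[of x 1] by force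
  have "scale (of_real t) (scale (of_real (1 / t)) x) \<in> S"
    using t by (intro absolutely_convex_scale x) simp
  then show ?thesis
    using t by simp
qed

lemma minkowski_add: "minkowski S (x + y) \<le> minkowski S x + minkowski S y"
proof -
  have "minkowski S (x + y) - minkowski S x \<le> minkowski S y"
  proof (rule minkowski_greatest)
    fix s
    assume s: "0 < s" "scale (of_real (1 / s)) y \<in> S"
    have "minkowski S (x + y) - s \<le> minkowski S x"
    proof (rule minkowski_greatest)
      fix t
      assume t: "0 < t" "scale (of_real (1 / t)) x \<in> S"
      have "scale (of_real (t / (t + s))) (scale (of_real (1 / t)) x) +
          scale (of_real (s / (t + s))) (scale (of_real (1 / s)) y) \<in> S"
      proof (rule absolutely_convex_combination[OF t(2) s(2)])
        have "norm (complex_of_real (t / (t + s))) + norm (complex_of_real (s / (t + s)))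
            = t / (t + s) + s / (t + s)"
          using s(1) t(1) by (simp only: norm_of_real) simp
        also have "\<dots> = 1"
          using s(1) t(1) by (simp add: add_divide_distrib[symmetric])
        finally show "norm (complex_of_real (t / (t + s))) + norm (complex_of_real (s / (t + s))) \<le> 1"
          by simp
      qed
      moreover have "complex_of_real (t / (t + s)) * of_real (1 / t) = of_real (1 / (t + s))"
        "complex_of_real (s / (t + s)) * of_real (1 / s) = of_real (1 / (t + s))"
        using s(1) t(1) unfolding of_real_mult[symmetric] of_real_eq_iff by simp_all
      ultimately have "scale (of_real (1 / (t + s))) (x + y) \<in> S"
        by (simp only: scale_scale scale_right_distrib)
      then show "minkowski S (x + y) - s \<le> t"
        using minkowski_le[of "t + s" "x + y"] s(1) t(1) by simp
    qed
    then show "minkowski S (x + y) - minkowski S x \<le> s"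
      by simp
  qed
  then show ?thesis
    by simp
qed

lemma minkowski_zero: "minkowski S 0 = 0"
proof (rule antisym)
  show "minkowski S 0 \<le> 0"
  proof (rule field_le_epsilon)
    fix e :: real
    assume "0 < e"
    then show "minkowski S 0 \<le> 0 + e"
      using minkowski_le[of e 0] V by auto
  qed
  show "0 \<le> minkowski S 0"
    by (rule minkowski_greatest) simp
qed

lemma minkowski_scale_le:
  assumes "c \<noteq> 0"
  shows "minkowski S (scale c x) \<le> norm c * minkowski S x"
proof -
  have "minkowski S (scale c x) / norm c \<le> minkowski S x"
  proof (rule minkowski_greatest)
    fix t
    assume t: "0 < t" "scale (of_real (1 / t)) x \<in> S"
    have "scale (c / of_real (norm c)) (scale (of_real (1 / t)) x) \<in> S"
      using assms by (intro absolutely_convex_scale t(2)) (simp add: norm_divide)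
    moreover have "c / of_real (norm c) * of_real (1 / t) = of_real (1 / (norm c * t)) * c"
      by simp
    ultimately have "scale (of_real (1 / (norm c * t))) (scale c x) \<in> S"
      by (simp only: scale_scale)
    then have "minkowski S (scale c x) \<le> norm c * t"
      using assms t(1) by (intro minkowski_le) auto
    then show "minkowski S (scale c x) / norm c \<le> t"
      using assms by (simp add: field_simps)
  qed
  then show ?thesis
    using assms by (simp add: field_simps)
qed

lemma minkowski_scale: "minkowski S (scale c x) = norm c * minkowski S x"
proof (cases "c = 0")
  case True
  then show ?thesis
    by (simp add: minkowski_zero)
next
  case False
  have "minkowski S x \<le> minkowski S (scale c x) / norm c"
    using minkowski_scale_le[of "1 / c" "scale c x"] False by (simp add: norm_divide)
  then show ?thesis
    using minkowski_scale_le[OF False, of x] False by (simp add: field_simps)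
qed

lemma minkowski_nonneg: "0 \<le> minkowski S x"
  by (rule minkowski_greatest) simp

lemma minkowski_tendsto_zero: "(minkowski S \<longlongrightarrow> 0) (nhds 0)"
proof (rule tendstoI)
  fix e :: real
  assume e: "0 < e"
  have "((\<lambda>x. scale (of_real (2 / e)) x) \<longlongrightarrow> scale (of_real (2 / e)) 0) (nhds 0)"
    by (intro tendsto_scale tendsto_const filterlim_ident)
  then have "\<forall>\<^sub>F x in nhds 0. scale (of_real (2 / e)) x \<in> V"
    using V by (intro topological_tendstoD[of _ 0]) simp_all
  then show "\<forall>\<^sub>F x in nhds 0. dist (minkowski S x) 0 < e"
  proof (rule eventually_mono)
    fix x
    assume "scale (of_real (2 / e)) x \<in> V"
    then have "scale (of_real (1 / (e / 2))) x \<in> S"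
      using V(3) by auto
    then have "minkowski S x \<le> e / 2"
      using e by (intro minkowski_le) simp_all
    then show "dist (minkowski S x) 0 < e"
      using e minkowski_nonneg[of x] by (simp add: dist_real_def)
  qed
qed

lemma continuous_seminorm_minkowski: "continuous_seminorm (minkowski S)"
  unfolding continuous_seminorm_def
proof (intro conjI allI minkowski_nonneg minkowski_add minkowski_scale continuous_if_diff_le)
  fix x y
  have "minkowski S (y - x) = minkowski S (x - y)"
    using minkowski_scale[of "-1" "x - y"] by simp
  then show "\<bar>minkowski S x - minkowski S y\<bar> \<le> minkowski S (x - y)"
    using minkowski_add[of "x - y" y] minkowski_add[of "y - x" x] by simp
qed (rule minkowski_tendsto_zero)

end

text \<open>A convex neighbourhood \<open>V\<close> of zero contains the absolutely convex set of all points whose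
  multiples by scalars of modulus at most one lie in \<open>V\<close>. That set is still a neighbourhood of zero,
  because multiplication of scalars and vectors is jointly continuous at the origin.\<close>

lemma seminorm_ball_subset:
  assumes U: "open U" "0 \<in> U"
  obtains p where "continuous_seminorm p" "\<And>x. p x < 1 \<Longrightarrow> x \<in> U"
proof -
  obtain V where V: "open V" "0 \<in> V" "V \<subseteq> U"
    and convex: "\<And>x y s t. x \<in> V \<Longrightarrow> y \<in> V \<Longrightarrow> 0 \<le> s \<Longrightarrow> 0 \<le> t \<Longrightarrow> s + t = 1 \<Longrightarrow>
      scale (of_real s) x + scale (of_real t) y \<in> V"
    using locally_convex[OF U] by metis
  define S where "S = {x. \<forall>c. norm c \<le> 1 \<longrightarrow> scale c x \<in> V}"
  \<comment> \<open>As \<open>0 \<in> V\<close>, the missing weight of a combination can be put on zero.\<close>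
  have convex0: "scale (of_real s) x + scale (of_real t) y \<in> V"
    if "x \<in> V" "y \<in> V" "0 \<le> s" "0 \<le> t" "s + t \<le> 1" for x y s t
  proof (cases "s + t = 0")
    case True
    then have "s = 0" "t = 0"
      using that by simp_all
    then show ?thesis
      using V by simp
  next
    case False
    have "s / (s + t) + t / (s + t) = 1"
      unfolding add_divide_distrib[symmetric] using False by (rule divide_self)
    then have "scale (of_real (s / (s + t))) x + scale (of_real (t / (s + t))) y \<in> V"
      using that by (intro convex) simp_all
    then have "scale (of_real (s + t)) (scale (of_real (s / (s + t))) x + scale (of_real (t / (s + t))) y)
        + scale (of_real (1 - (s + t))) 0 \<in> V"
      using that(3-5) V(2) by (intro convex[where y = 0]) (simp_all del: of_real_divide of_real_add)
    moreover have "complex_of_real (s + t) * of_real (s / (s + t)) = of_real s"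
      "complex_of_real (s + t) * of_real (t / (s + t)) = of_real t"
      using False unfolding of_real_mult[symmetric] of_real_eq_iff by simp_all
    ultimately show ?thesis
      by (simp only: scale_right_distrib scale_scale scale_zero_right add_0_right)
  qed
  have "absolutely_convex S"
    unfolding absolutely_convex_def
  proof (intro ballI allI impI)
    fix x y and c d :: complex
    assume x: "x \<in> S" and y: "y \<in> S" and cd: "norm c + norm d \<le> 1"
    have polar: "\<exists>u. norm u \<le> 1 \<and> a = of_real (norm a) * u" for a :: complex
      by (rule exI[of _ "sgn a"]) (simp add: norm_sgn, simp add: sgn_div_norm scaleR_conv_of_real)
    show "scale c x + scale d y \<in> S"
      unfolding S_def
    proof (intro CollectI allI impI)
      fix e :: complex
      assume e: "norm e \<le> 1"
      obtain u v where u: "norm u \<le> 1" "e * c = of_real (norm (e * c)) * u"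
        and v: "norm v \<le> 1" "e * d = of_real (norm (e * d)) * v"
        using polar by metis
      have "norm (e * c) + norm (e * d) = norm e * (norm c + norm d)"
        by (simp add: norm_mult distrib_left)
      also have "\<dots> \<le> 1 * 1"
        using e cd by (intro mult_mono) auto
      finally have "scale (of_real (norm (e * c))) (scale u x)
          + scale (of_real (norm (e * d))) (scale v y) \<in> V"
        using x y u(1) v(1) by (intro convex0) (auto simp: S_def)
      then have "scale (e * c) x + scale (e * d) y \<in> V"
        by (simp only: scale_scale u(2)[symmetric] v(2)[symmetric])
      then show "scale e (scale c x + scale d y) \<in> V"
        by (simp add: scale_right_distrib)
    qed
  qed
  moreover obtain N where "open N" "0 \<in> N" "N \<subseteq> S"
  proof -
    have "((\<lambda>z. scale (fst z) (snd z)) \<longlongrightarrow> scale 0 0) (nhds (0 :: complex) \<times>\<^sub>F nhds 0)"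
      by (intro tendsto_scale filterlim_fst filterlim_snd)
    then have "\<forall>\<^sub>F z in nhds (0 :: complex) \<times>\<^sub>F nhds 0. scale (fst z) (snd z) \<in> V"
      using V by (intro topological_tendstoD[of _ 0]) simp_all
    then obtain P Q where P: "\<forall>\<^sub>F c in nhds (0 :: complex). P c" and Q: "\<forall>\<^sub>F x in nhds (0 :: 'a). Q x"
      and PQ: "\<And>c x. P c \<Longrightarrow> Q x \<Longrightarrow> scale c x \<in> V"
      unfolding eventually_prod_filter by auto
    obtain r where r: "0 < r" "\<And>c. norm c \<le> r \<Longrightarrow> P c"
    proof -
      obtain r where "0 < r" "\<And>c. dist c 0 < r \<Longrightarrow> P c"
        using P unfolding eventually_nhds_metric by blast
      then show thesis
        by (intro that[of "r / 2"]) auto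
    qed
    have "((\<lambda>x. scale (of_real (1 / r)) x) \<longlongrightarrow> scale (of_real (1 / r)) 0) (nhds 0)"
      by (intro tendsto_scale tendsto_const filterlim_ident)
    then have "filterlim (\<lambda>x. scale (of_real (1 / r)) x) (nhds 0) (nhds 0)"
      by simp
    from eventually_compose_filterlim[OF Q this]
    obtain N where N: "open N" "0 \<in> N" "\<And>x. x \<in> N \<Longrightarrow> Q (scale (of_real (1 / r)) x)"
      unfolding eventually_nhds by blast
    show thesis
    proof (rule that[OF N(1,2)], rule subsetI)
      fix x
      assume x: "x \<in> N"
      show "x \<in> S"
        unfolding S_def
      proof (intro CollectI allI impI)
        fix c :: complex
        assume c: "norm c \<le> 1"
        have "norm (c * of_real r) \<le> r"
          using r(1) c by (simp add: norm_mult mult_left_le_one_le)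
        then have "scale (c * of_real r) (scale (of_real (1 / r)) x) \<in> V"
          using N(3)[OF x] by (intro PQ r)
        then show "scale c x \<in> V"
          using r(1) by simp
      qed
    qed
  qed
  ultimately have "continuous_seminorm (minkowski S)" "\<And>x. minkowski S x < 1 \<Longrightarrow> x \<in> S"
    using continuous_seminorm_minkowski minkowski_less_one by blast+
  moreover have "S \<subseteq> U"
  proof
    fix x
    assume "x \<in> S"
    then have "scale 1 x \<in> V"
      unfolding S_def by (auto dest!: spec[of _ 1])
    then show "x \<in> U"
      using V by auto
  qed
  ultimately show thesis
    using that by blast
qed

lemma tendsto_iff_seminorms:
  "(f \<longlongrightarrow> l) F \<longleftrightarrow> (\<forall>p. continuous_seminorm p \<longrightarrow> ((\<lambda>n. p (f n - l)) \<longlongrightarrow> 0) F)"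
proof (intro iffI allI impI)
  fix p
  assume f: "(f \<longlongrightarrow> l) F" and p: "continuous_seminorm p"
  have "((\<lambda>n. f n - l) \<longlongrightarrow> l - l) F"
    by (intro tendsto_intros f)
  then show "((\<lambda>n. p (f n - l)) \<longlongrightarrow> 0) F"
    by (intro seminorm_tendsto_zero[OF p]) simp
next
  assume lim: "\<forall>p. continuous_seminorm p \<longrightarrow> ((\<lambda>n. p (f n - l)) \<longlongrightarrow> 0) F"
  have "((\<lambda>n. f n - l) \<longlongrightarrow> 0) F"
  proof (rule topological_tendstoI)
    fix U :: "'a set"
    assume "open U" "0 \<in> U"
    then obtain p where p: "continuous_seminorm p" "\<And>x. p x < 1 \<Longrightarrow> x \<in> U"
      using seminorm_ball_subset by blast
    have "\<forall>\<^sub>F n in F. p (f n - l) < 1"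
      using lim p(1) by (intro order_tendstoD(2)) auto
    then show "\<forall>\<^sub>F n in F. f n - l \<in> U"
      by (rule eventually_mono) (rule p(2))
  qed
  from tendsto_add[OF this tendsto_const[of l]] show "(f \<longlongrightarrow> l) F"
    by simp
qed

lemma seminorm_separates:
  assumes "x \<noteq> 0"
  obtains p where "continuous_seminorm p" "0 < p x"
proof -
  obtain U where "open U" "0 \<in> U" "x \<notin> U"
    using separation_t1[of 0 x] assms by auto
  then obtain p where "continuous_seminorm p" "\<And>y. p y < 1 \<Longrightarrow> y \<in> U"
    using seminorm_ball_subset by blast
  moreover from this have "\<not> p x < 1"
    using \<open>x \<notin> U\<close> by blast
  ultimately show thesis
    by (intro that[of p]) auto
qed

lemma bounded_set_if_seminorms_bounded:
  assumes "\<And>p. continuous_seminorm p \<Longrightarrow> \<exists>r. \<forall>x\<in>S. p x \<le> r"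
  shows "bounded_set S"
  unfolding bounded_set_def
proof (intro allI impI)
  fix U :: "'a set"
  assume "open U \<and> 0 \<in> U"
  then obtain p where p: "continuous_seminorm p" "\<And>x. p x < 1 \<Longrightarrow> x \<in> U"
    using seminorm_ball_subset by blast
  obtain r where r: "\<And>x. x \<in> S \<Longrightarrow> p x \<le> r"
    using assms[OF p(1)] by blast
  show "\<exists>R>0. \<forall>c. R \<le> norm c \<longrightarrow> S \<subseteq> scale c ` U"
  proof (intro exI[of _ "\<bar>r\<bar> + 1"] conjI allI impI subsetI)
    fix c :: complex and x
    assume c: "\<bar>r\<bar> + 1 \<le> norm c" and x: "x \<in> S"
    have "c \<noteq> 0"
      using c by auto
    moreover have "p (scale (1 / c) x) < 1"
    proof -
      have "p (scale (1 / c) x) = p x / norm c"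
        by (simp add: seminorm_scale[OF p(1)] norm_divide)
      also have "\<dots> < 1"
        using r[OF x] c \<open>c \<noteq> 0\<close> by (simp add: field_simps)
      finally show ?thesis .
    qed
    ultimately show "x \<in> scale c ` U"
      using p(2) by (intro image_eqI[of _ _ "scale (1 / c) x"]) auto
  qed simp
qed

lemma dual_iff:
  "f \<in> dual \<longleftrightarrow> (\<forall>x y. f (x + y) = f x + f y) \<and> (\<forall>c x. f (scale c x) = c * f x)
     \<and> continuous_on UNIV f"
  unfolding dual_def Vector_Spaces.linear_iff
  using vector_space_axioms vector_space_over_itself.vector_space_axioms by auto

lemma
  assumes "f \<in> dual"
  shows dual_add: "f (x + y) = f x + f y"
    and dual_scale: "f (scale c x) = c * f x"
    and dual_zero: "f 0 = 0"
    and dual_diff: "f (x - y) = f x - f y"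
    and dual_sum: "f (\<Sum>i\<in>I. h i) = (\<Sum>i\<in>I. f (h i))"
proof -
  show add: "f (x + y) = f x + f y" for x y
    using assms by (simp add: dual_iff)
  show scale: "f (scale c x) = c * f x" for c x
    using assms by (simp add: dual_iff)
  show zero: "f 0 = 0"
    using scale[of 0 0] by simp
  show "f (x - y) = f x - f y"
    using add[of "x - y" y] by simp
  show "f (\<Sum>i\<in>I. h i) = (\<Sum>i\<in>I. f (h i))"
    by (induction I rule: infinite_finite_induct) (simp_all add: zero add)
qed

lemma dual_tendsto: "f \<in> dual \<Longrightarrow> (h \<longlongrightarrow> x) F \<Longrightarrow> ((\<lambda>n. f (h n)) \<longlongrightarrow> f x) F"
  by (rule isCont_tendsto_compose[of x f h F])
    (auto simp: dual_iff continuous_on_eq_continuous_at)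

lemma continuous_seminorm_dual: "f \<in> dual \<Longrightarrow> continuous_seminorm (\<lambda>x. norm (f x))"
  unfolding continuous_seminorm_def
  by (simp add: dual_add dual_scale norm_mult norm_triangle_ineq)
    (auto simp: dual_iff intro: continuous_on_norm)

text \<open>The constraints \<open>t * d \<le> g (w + t y)\<close> for \<open>w \<in> W\<close> and \<open>t \<ge> 0\<close> force a real functional \<open>g\<close>
  to vanish on \<open>W\<close> and to be at least \<open>d\<close> at \<open>y\<close>. It is the real part of the complex
  functional \<open>\<lambda>x. g x - \<i> * g (\<i> x)\<close>, which also vanishes on the complex subspace \<open>W\<close>.\<close>

lemma hahn_banach_separation:
  assumes q: "continuous_seminorm q" and W: "subspace W" and d: "\<And>w. w \<in> W \<Longrightarrow> d \<le> q (w + y)"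
  obtains f where "f \<in> dual" "\<And>w. w \<in> W \<Longrightarrow> f w = 0" "d \<le> Re (f y)"
proof -
  define rscale where "rscale r = scale (of_real r)" for r :: real
  interpret R: real_linear_space rscale
    by unfold_locales (simp_all add: rscale_def scale_right_distrib scale_left_distrib)
  have sub: "R.sublinear q"
    using seminorm_add[OF q] seminorm_scale[OF q] by (auto simp: R.sublinear_def rscale_def)
  define K where "K = {(w + rscale t y, t * d) | w t. w \<in> W \<and> 0 \<le> t}"
  have K_iff: "(k, r) \<in> K \<longleftrightarrow> (\<exists>w\<in>W. \<exists>t\<ge>0. k = w + rscale t y \<and> r = t * d)" for k r
    by (auto simp: K_def)
  have cone: "R.constraint_cone K"
  proof (rule R.constraint_coneI)
    show "K \<noteq> {}"
      using subspace_0[OF W] by (auto simp: K_def)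
  next
    fix k r k' r'
    assume "(k, r) \<in> K" "(k', r') \<in> K"
    then obtain w s w' t where "w \<in> W" "w' \<in> W" "0 \<le> s" "0 \<le> t"
      "k = w + rscale s y" "r = s * d" "k' = w' + rscale t y" "r' = t * d"
      unfolding K_iff by blast
    then show "(k + k', r + r') \<in> K"
      unfolding K_iff using subspace_add[OF W]
      by (intro bexI[of _ "w + w'"] exI[of _ "s + t"])
        (simp_all add: R.scale_left_distrib distrib_right)
  next
    fix k r and t :: real
    assume t: "(k, r) \<in> K" "0 \<le> t"
    then obtain w s where w: "w \<in> W" "0 \<le> s" "k = w + rscale s y" "r = s * d"
      unfolding K_iff by blast
    have "rscale t w \<in> W"
      unfolding rscale_def by (rule subspace_scale[OF W w(1)])
    then show "(rscale t k, t * r) \<in> K"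
      unfolding K_iff using w t(2)
      by (intro bexI[of _ "rscale t w"] exI[of _ "t * s"]) (simp_all add: R.scale_right_distrib)
  qed
  have below: "r \<le> q k" if kr: "(k, r) \<in> K" for k r
  proof -
    obtain w t where w: "w \<in> W" and t: "0 \<le> t" and k: "k = w + rscale t y" and r: "r = t * d"
      using kr K_iff by blast
    show ?thesis
    proof (cases "t = 0")
      case True
      then show ?thesis
        using r seminorm_nonneg[OF q] by simp
    next
      case False
      have "d \<le> q (rscale (1 / t) w + y)"
        using subspace_scale[OF W w] by (intro d) (simp add: rscale_def)
      then have "t * d \<le> t * q (rscale (1 / t) w + y)"
        using t by (rule mult_left_mono)
      also have "\<dots> = q (rscale t (rscale (1 / t) w + y))"
        using R.sublinear_scale[OF sub t] by simp
      also have "rscale t (rscale (1 / t) w + y) = k"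
        using False by (simp add: R.scale_right_distrib k)
      finally show ?thesis
        by (simp add: r)
    qed
  qed
  obtain g where add: "\<And>x y. g (x + y) = g x + g y" and hom: "\<And>t x. g (rscale t x) = t * g x"
    and le: "\<And>x. g x \<le> q x" and ge: "\<And>k r. (k, r) \<in> K \<Longrightarrow> r \<le> g k"
    using R.mazur_orlicz[OF sub cone below] by metis
  have minus: "g (- x) = - g x" for x
    using hom[of "-1" x] by simp
  have diff: "g (x - y) = g x - g y" for x y
    using add[of x "- y"] minus by simp
  have g_W: "g w = 0" if w: "w \<in> W" for w
  proof -
    have "0 \<le> g v" if "v \<in> W" for v
    proof -
      have "(v + rscale 0 y, 0 * d) \<in> K"
        unfolding K_iff using that by (intro bexI[of _ v] exI[of _ 0]) simp_all
      then show ?thesis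
        using ge[of v 0] by simp
    qed
    from this[OF w] this[OF subspace_neg[OF W w]] show ?thesis
      by (simp add: minus)
  qed
  have "(0 + rscale 1 y, 1 * d) \<in> K"
    unfolding K_iff using subspace_0[OF W] by (intro bexI[of _ 0] exI[of _ 1]) simp_all
  then have g_y: "d \<le> g y"
    using ge[of y d] by simp
  have cont: "continuous_on UNIV g"
  proof (rule continuous_if_diff_le)
    fix x y
    have "g (- (x - y)) \<le> q (x - y)"
      using le[of "- (x - y)"] by (simp only: seminorm_minus[OF q])
    then show "\<bar>g x - g y\<bar> \<le> q (x - y)"
      using le[of "x - y"] unfolding minus diff by simp
  next
    show "(q \<longlongrightarrow> 0) (nhds 0)"
      by (rule seminorm_tendsto_zero[OF q filterlim_ident])
  qed
  define f where "f x = of_real (g x) - \<i> * of_real (g (scale \<i> x))" for x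
  have f_add: "f (x + y) = f x + f y" for x y
    by (simp add: f_def add scale_right_distrib algebra_simps)
  have f_real: "f (scale (of_real r) x) = of_real r * f x" for r x
    using hom[of r x] hom[of r "scale \<i> x"]
    by (simp add: f_def rscale_def mult.commute algebra_simps)
  have f_i: "f (scale \<i> x) = \<i> * f x" for x
    by (simp add: f_def minus algebra_simps)
  show thesis
  proof (rule that[of f])
    show "f \<in> dual"
      unfolding dual_iff
    proof (intro conjI allI f_add)
      fix c x
      have "scale c x = scale (of_real (Re c)) x + scale (of_real (Im c)) (scale \<i> x)"
        by (subst complex_eq[of c]) (simp add: scale_left_distrib mult.commute)
      then have "f (scale c x) = (of_real (Re c) + \<i> * of_real (Im c)) * f x"
        by (simp only: f_add f_real f_i) (simp add: algebra_simps)
      then show "f (scale c x) = c * f x"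
        by (simp add: complex_eq[symmetric])
    next
      have "continuous_on UNIV (\<lambda>x. scale \<i> x)"
        by (simp add: continuous_on_def)
          (auto intro!: tendsto_scale tendsto_intros)
      then have "continuous_on UNIV (\<lambda>x. g (scale \<i> x))"
        by (rule continuous_on_compose2[OF cont]) simp
      then show "continuous_on UNIV f"
        unfolding f_def by (intro continuous_intros cont)
    qed
    show "f w = 0" if "w \<in> W" for w
      using that subspace_scale[OF W that] by (simp add: f_def g_W)
    show "d \<le> Re (f y)"
      using g_y by (simp add: f_def)
  qed
qed

end

section \<open>Weak cluster points in semi-reflexive spaces\<close>

context locally_convex_space
begin

text \<open>By Tychonoff's theorem the evaluations \<open>\<lambda>f. f (s n)\<close> have a cluster point in the product of
  the discs that contain the values \<open>f (s n)\<close>. Along a suitable filter \<open>G\<close> they converge to it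
  pointwise, which makes it linear on the dual and bounded on the polar of the range of \<open>s\<close>. So it
  belongs to the strong bidual, and semi-reflexivity represents it by a point.\<close>

lemma weak_cluster_point:
  assumes semi_reflexive
    and bounded: "\<And>p. continuous_seminorm p \<Longrightarrow> \<exists>r. \<forall>n. p (s n) \<le> r"
  obtains z and G :: "nat filter" where "G \<noteq> bot" "G \<le> sequentially"
    "\<And>f. f \<in> dual \<Longrightarrow> ((\<lambda>n. f (s n)) \<longlongrightarrow> f z) G"
proof -
  \<comment> \<open>The value 0 off the dual only serves to keep \<open>\<Phi> n\<close> in a product of discs.\<close>
  define \<Phi> where "\<Phi> n f = (if f \<in> dual then f (s n) else 0)" for n and f :: "'a \<Rightarrow> complex"
  have "\<forall>f. \<exists>r. f \<in> dual \<longrightarrow> (\<forall>n. norm (f (s n)) \<le> r)"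
    using bounded[OF continuous_seminorm_dual] by blast
  then obtain r where r: "\<And>f n. f \<in> dual \<Longrightarrow> norm (f (s n)) \<le> r f"
    by metis
  define X where "X = (\<Pi>\<^sub>E f\<in>UNIV. cball 0 \<bar>r f\<bar> :: complex set)"
  have "compact X"
    unfolding X_def compactin_euclidean_iff[symmetric] euclidean_product_topology[symmetric]
    by (simp add: compactin_PiE)
  moreover have "\<Phi> n \<in> X" for n
    using order_trans[OF r abs_ge_self] by (auto simp: X_def \<Phi>_def)
  ultimately obtain u where u: "inf (nhds u) (filtermap \<Phi> sequentially) \<noteq> bot"
    unfolding compact_filter by (metis (no_types, lifting) always_eventually eventually_filtermap
        filtermap_bot_iff sequentially_bot)
  define G where "G = inf sequentially (filtercomap \<Phi> (nhds u))"
  have G_bot: "G \<noteq> bot"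
  proof
    assume "G = bot"
    then have "\<forall>\<^sub>F n in G. False"
      by simp
    then obtain P Q where P: "eventually P sequentially" and Q: "eventually Q (nhds u)"
      and PQ: "\<And>n. P n \<Longrightarrow> Q (\<Phi> n) \<Longrightarrow> False"
      unfolding G_def eventually_inf eventually_filtercomap by metis
    have "eventually (\<lambda>v. \<not> Q v) (filtermap \<Phi> sequentially)"
      unfolding eventually_filtermap using P by (rule eventually_mono) (use PQ in blast)
    with Q have "eventually (\<lambda>v. False) (inf (nhds u) (filtermap \<Phi> sequentially))"
      unfolding eventually_inf by blast
    with u show False
      by (simp add: eventually_False)
  qed
  have G_seq: "G \<le> sequentially"
    by (simp add: G_def)
  have \<Phi>: "filterlim \<Phi> (nhds u) G"
    unfolding G_def by (rule filterlim_mono[OF filterlim_filtercomap order_refl inf_le2])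
  have \<Phi>_lim: "((\<lambda>n. \<Phi> n f) \<longlongrightarrow> u f) G" for f
  proof (rule topological_tendstoI)
    fix D :: "complex set"
    assume D: "open D" "u f \<in> D"
    have "open ((\<lambda>v. v f) -` D)"
      by (rule open_vimage[OF D(1) continuous_on_product_coordinates])
    then have "\<forall>\<^sub>F n in G. \<Phi> n \<in> (\<lambda>v. v f) -` D"
      using D(2) by (intro topological_tendstoD[OF \<Phi>]) simp_all
    then show "\<forall>\<^sub>F n in G. \<Phi> n f \<in> D"
      by simp
  qed
  have lim: "((\<lambda>n. f (s n)) \<longlongrightarrow> u f) G" if "f \<in> dual" for f
  proof -
    have "(\<lambda>n. \<Phi> n f) = (\<lambda>n. f (s n))"
      using that by (simp add: \<Phi>_def)
    with \<Phi>_lim[of f] show ?thesis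
      by (simp only:)
  qed
  have "u \<in> strong_bidual"
    unfolding strong_bidual_def
  proof (intro CollectI conjI ballI allI)
    fix f g
    assume f: "f \<in> dual" and g: "g \<in> dual"
    then have "(\<lambda>x. f x + g x) \<in> dual"
      by (auto simp: dual_iff algebra_simps intro: continuous_on_add)
    from lim[OF this] tendsto_add[OF lim[OF f] lim[OF g]]
    show "u (\<lambda>x. f x + g x) = u f + u g"
      by (rule tendsto_unique[OF G_bot])
  next
    fix c f
    assume f: "f \<in> dual"
    then have "(\<lambda>x. c * f x) \<in> dual"
      by (auto simp: dual_iff algebra_simps intro: continuous_on_mult_left)
    from lim[OF this] tendsto_mult_left[OF lim[OF f]]
    show "u (\<lambda>x. c * f x) = c * u f"
      by (rule tendsto_unique[OF G_bot])
  next
    have "bounded_set {}"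
      unfolding bounded_set_def by (auto intro: exI[of _ 1])
    then have "strong_open dual"
      unfolding strong_open_def by (auto simp: strong_nbhd_def intro!: exI[of _ "{}"] exI[of _ 1])
    then have top: "topspace strong_topology = dual"
      unfolding topspace_def openin_strong_topology by (auto simp: strong_open_def)
    show "continuous_map strong_topology euclidean u"
      unfolding continuous_map_def top openin_strong_topology
    proof (intro conjI allI impI)
      fix O' :: "complex set"
      assume "openin euclidean O'"
      then have O': "open O'"
        by simp
      show "strong_open {f \<in> dual. u f \<in> O'}"
        unfolding strong_open_def
      proof (intro conjI ballI)
        fix f
        assume "f \<in> {f \<in> dual. u f \<in> O'}"
        then have f: "f \<in> dual" "u f \<in> O'"
          by auto
        then obtain e where e: "0 < e" "cball (u f) e \<subseteq> O'"
          using O' open_contains_cball by blast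
        have "bounded_set (range s)"
          using bounded by (intro bounded_set_if_seminorms_bounded) auto
        moreover have "strong_nbhd f (range s) e \<subseteq> {f \<in> dual. u f \<in> O'}"
        proof
          fix g
          assume "g \<in> strong_nbhd f (range s) e"
          then have g: "g \<in> dual" and le: "\<And>n. norm (g (s n) - f (s n)) \<le> e"
            by (auto simp: strong_nbhd_def)
          have "((\<lambda>n. norm (g (s n) - f (s n))) \<longlongrightarrow> norm (u g - u f)) G"
            by (intro tendsto_norm tendsto_diff lim f g)
          then have "norm (u g - u f) \<le> e"
            by (rule tendsto_upperbound) (simp_all add: le G_bot)
          then have "u g \<in> cball (u f) e"
            by (simp add: dist_norm norm_minus_commute)
          then show "g \<in> {f \<in> dual. u f \<in> O'}"
            using e g by auto
        qed
        ultimately show "\<exists>S e. bounded_set S \<and> 0 < e \<and> strong_nbhd f S e \<subseteq> {f \<in> dual. u f \<in> O'}"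
          using e(1) by blast
      qed blast
    qed simp
  qed
  then obtain z where "\<And>f. f \<in> dual \<Longrightarrow> u f = f z"
    using \<open>semi_reflexive\<close> unfolding semi_reflexive_def by blast
  then show thesis
    using that[OF G_bot G_seq, of z] lim by simp
qed

end

section \<open>The mean ergodic theorem and the comparison of means\<close>

text \<open>Toeplitz' theorem for null sequences: beyond some \<open>N\<close> the terms of \<open>e\<close> are small, and the bound
  on the row sums keeps their contribution small, while the finitely many columns before \<open>N\<close> tend
  to zero.\<close>

lemma toeplitz_null:
  fixes c :: "nat \<Rightarrow> nat \<Rightarrow> real"
  assumes nonneg: "\<And>n i. 0 \<le> c n i" and rows: "\<And>n. (\<Sum>i\<le>n. c n i) \<le> H"
    and cols: "\<And>i. (\<lambda>n. c n i) \<longlonglongrightarrow> 0" and e: "e \<longlonglongrightarrow> 0"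
  shows "(\<lambda>n. \<Sum>i\<le>n. c n i * e i) \<longlonglongrightarrow> 0"
proof (rule LIMSEQ_I)
  fix d :: real
  assume d: "0 < d"
  have H: "0 \<le> H"
    using rows[of 0] nonneg[of 0 0] by simp
  \<comment> \<open>The denominator \<open>H + 1\<close> stays positive if \<open>H = 0\<close>.\<close>
  define d' where "d' = d / (2 * (H + 1))"
  have d': "0 < d'" "H * d' < d / 2"
    using d H by (auto simp: d'_def field_simps)
  obtain N where N: "\<And>i. N \<le> i \<Longrightarrow> \<bar>e i\<bar> < d'"
    using LIMSEQ_D[OF e d'(1)] by auto
  have "(\<lambda>n. \<Sum>i<N. c n i * \<bar>e i\<bar>) \<longlonglongrightarrow> (\<Sum>i<N. 0 * \<bar>e i\<bar>)"
    by (intro tendsto_intros cols)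
  then have "(\<lambda>n. \<Sum>i<N. c n i * \<bar>e i\<bar>) \<longlonglongrightarrow> 0"
    by simp
  from LIMSEQ_D[OF this, of "d / 2"] d obtain M
    where M: "\<And>n. M \<le> n \<Longrightarrow> \<bar>\<Sum>i<N. c n i * \<bar>e i\<bar>\<bar> < d / 2"
    by auto
  show "\<exists>no. \<forall>n\<ge>no. norm ((\<Sum>i\<le>n. c n i * e i) - 0) < d"
  proof (intro exI[of _ M] allI impI)
    fix n
    assume n: "M \<le> n"
    have "norm (\<Sum>i\<le>n. c n i * e i) \<le> (\<Sum>i\<le>n. c n i * \<bar>e i\<bar>)"
      by (rule sum_norm_le) (simp add: abs_mult nonneg)
    also have "\<dots> \<le> (\<Sum>i\<le>n. (if i < N then c n i * \<bar>e i\<bar> else 0) + c n i * d')"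
    proof (rule sum_mono)
      fix i
      show "c n i * \<bar>e i\<bar> \<le> (if i < N then c n i * \<bar>e i\<bar> else 0) + c n i * d'"
        using N[of i] nonneg[of n i] d'(1) by (auto intro: mult_left_mono)
    qed
    also have "\<dots> = (\<Sum>i | i \<le> n \<and> i < N. c n i * \<bar>e i\<bar>) + (\<Sum>i\<le>n. c n i) * d'"
      by (simp add: sum.distrib sum_distrib_right sum.inter_filter[symmetric])
    also have "\<dots> \<le> (\<Sum>i<N. c n i * \<bar>e i\<bar>) + H * d'"
      using d'(1) by (intro add_mono sum_mono2 mult_right_mono rows) (auto simp: nonneg)
    also have "\<dots> < d"
      using M[OF n] d'(2) by simp
    finally show "norm ((\<Sum>i\<le>n. c n i * e i) - 0) < d"
      by simp
  qed
qed

lemma suminf_lower_triangular: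
  assumes "lower_triangular C" "\<And>c. h 0 c = (0 :: 'b :: {t2_space, comm_monoid_add})"
  shows "(\<Sum>i. h (C n i) i) = (\<Sum>i\<le>n. h (C n i) i)"
  using assms by (intro suminf_finite) (auto simp: lower_triangular_def)

context locally_convex_space
begin

lemma operator_iff:
  "operator T \<longleftrightarrow> (\<forall>x y. T (x + y) = T x + T y) \<and> (\<forall>c x. T (scale c x) = scale c (T x))
     \<and> continuous_on UNIV T"
  unfolding operator_def Vector_Spaces.linear_iff using vector_space_axioms by auto

context
  fixes T
  assumes T: "operator T"
begin

lemma operator_funpow_add: "(T ^^ i) (x + y) = (T ^^ i) x + (T ^^ i) y"
  and operator_funpow_scale: "(T ^^ i) (scale c x) = scale c ((T ^^ i) x)"
  using T by (induction i) (auto simp: operator_iff)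

lemma mean_add: "mean M T n (x + y) = mean M T n x + mean M T n y"
  by (simp add: mean_def operator_funpow_add scale_right_distrib sum.distrib)

lemma mean_scale: "mean M T n (scale c x) = scale c (mean M T n x)"
  by (simp add: mean_def operator_funpow_scale scale_sum_right mult.commute)

lemma mean_diff: "mean M T n (x - y) = mean M T n x - mean M T n y"
  using mean_add[of M n "x - y" y] by simp

lemma subspace_range_minus_id: "subspace (range (\<lambda>x. T x - x))"
proof (rule subspaceI)
  have T0: "T 0 = 0"
    using T operator_iff[of T] scale_zero_left by metis
  show "0 \<in> range (\<lambda>x. T x - x)"
    by (rule image_eqI[of _ _ 0]) (simp_all add: T0)
next
  fix v w
  assume "v \<in> range (\<lambda>x. T x - x)" "w \<in> range (\<lambda>x. T x - x)"
  then obtain x y where "v = T x - x" "w = T y - y"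
    by blast
  then show "v + w \<in> range (\<lambda>x. T x - x)"
    using T by (intro image_eqI[of _ _ "x + y"]) (simp_all add: operator_iff)
next
  fix c v
  assume "v \<in> range (\<lambda>x. T x - x)"
  then obtain x where "v = T x - x"
    by blast
  then show "scale c v \<in> range (\<lambda>x. T x - x)"
    using T by (intro image_eqI[of _ _ "scale c x"]) (simp_all add: operator_iff scale_right_diff_distrib)
qed

end

lemma mean_fixed_point:
  assumes "probability_matrix M" "T z = z"
  shows "mean M T n z = z"
proof -
  have "(T ^^ i) z = z" for i
    using assms(2) by (induction i) auto
  then show ?thesis
    using assms(1) by (simp add: mean_def scale_sum_left[symmetric] probability_matrix_def)
qed

lemma invariant_functional_mean:
  assumes M: "probability_matrix M" and f: "f \<in> dual" "\<And>x. f (T x) = f x"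
  shows "f (mean M T n x) = f x"
proof -
  have "f ((T ^^ i) x) = f x" for i
    by (induction i) (simp_all add: f(2))
  then have "f (mean M T n x) = (\<Sum>i\<le>n. M n i) * f x"
    by (simp add: mean_def dual_sum[OF f(1)] dual_scale[OF f(1)] sum_distrib_right)
  then show ?thesis
    using M by (simp add: probability_matrix_def)
qed

text \<open>The mean ergodic theorem. A weak cluster point \<open>z\<close> of the means of \<open>x\<close> is a fixed point,
  since \<open>T - id\<close> maps the means to a null sequence. Functionals that vanish on the range of
  \<open>T - id\<close> do not distinguish \<open>x\<close> from its means, and hence not from \<open>z\<close>; by Hahn-Banach \<open>x - z\<close> lies
  in the closure of that range. There the means tend to zero: on the range by assumption, on
  the closure because the means are equicontinuous. As the means fix \<open>z\<close>, those of \<open>x\<close> tend to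
  \<open>z\<close>.\<close>

lemma mean_ergodic:
  assumes A: "probability_matrix A" and refl: semi_reflexive and T: "operator T"
    and bounded: "matrix_bounded A T"
    and left: "(\<lambda>n. T (mean A T n x) - mean A T n x) \<longlonglongrightarrow> 0"
    and right: "\<And>y. (\<lambda>n. mean A T n (T y - y)) \<longlonglongrightarrow> 0"
  shows "\<exists>z. T z = z \<and> (\<lambda>n. mean A T n x) \<longlonglongrightarrow> z"
proof -
  have "\<exists>r. \<forall>n. p (mean A T n x) \<le> r" if "continuous_seminorm p" for p
    using bounded that unfolding matrix_bounded_def by blast
  then obtain z and G :: "nat filter" where G: "G \<noteq> bot" "G \<le> sequentially"
    and z: "\<And>f. f \<in> dual \<Longrightarrow> ((\<lambda>n. f (mean A T n x)) \<longlongrightarrow> f z) G"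
    using weak_cluster_point[OF refl, of "\<lambda>n. mean A T n x"] by metis
  have fixed: "T z = z"
  proof (rule ccontr)
    assume "T z \<noteq> z"
    then obtain p where p: "continuous_seminorm p" "0 < p (T z - z)"
      using seminorm_separates[of "T z - z"] by auto
    obtain f where f: "f \<in> dual" "p (T z - z) \<le> Re (f (T z - z))"
      using hahn_banach_separation[OF p(1) subspace_single_0, of "p (T z - z)" "T z - z"] by auto
    have "(\<lambda>x. f (T x)) \<in> dual"
      using f(1) T by (auto simp: dual_iff operator_iff intro: continuous_on_compose2)
    from tendsto_diff[OF z[OF this] z[OF f(1)]]
    have "((\<lambda>n. f (T (mean A T n x) - mean A T n x)) \<longlongrightarrow> f (T z - z)) G"
      by (simp add: dual_diff[OF f(1)])
    moreover have "((\<lambda>n. f (T (mean A T n x) - mean A T n x)) \<longlongrightarrow> f 0) G"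
      by (rule dual_tendsto[OF f(1) tendsto_mono[OF G(2) left]])
    ultimately have "f (T z - z) = f 0"
      by (rule tendsto_unique[OF G(1)])
    then show False
      using f p(2) by (simp add: dual_zero)
  qed
  have approx: "\<exists>w. q (x - z - (T w - w)) < e" if q: "continuous_seminorm q" and e: "0 < e" for q e
  proof (rule ccontr)
    assume no: "\<nexists>w. q (x - z - (T w - w)) < e"
    have "e \<le> q (v + (x - z))" if "v \<in> range (\<lambda>w. T w - w)" for v
    proof -
      have "- v \<in> range (\<lambda>w. T w - w)"
        by (rule subspace_neg[OF subspace_range_minus_id[OF T] that])
      then obtain w where "- v = T w - w"
        by blast
      then have "v = - (T w - w)"
        by (simp only: minus_equation_iff[of v])
      then have "v + (x - z) = x - z - (T w - w)"
        by simp
      moreover have "e \<le> q (x - z - (T w - w))"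
        using no by (simp only: not_ex not_less)
      ultimately show ?thesis
        by (simp only:)
    qed
    then obtain f where f: "f \<in> dual" "\<And>v. v \<in> range (\<lambda>w. T w - w) \<Longrightarrow> f v = 0"
      and fe: "e \<le> Re (f (x - z))"
      using hahn_banach_separation[OF q subspace_range_minus_id[OF T]] by blast
    have "f (T y) = f y" for y
      using f(2)[of "T y - y"] by (simp add: dual_diff[OF f(1)])
    from z[OF f(1), unfolded invariant_functional_mean[where x = x, OF A f(1) this]]
    have "f x = f z"
      by (rule tendsto_unique[OF G(1) tendsto_const])
    then show False
      using fe e by (simp add: dual_diff[OF f(1)])
  qed
  have "(\<lambda>n. mean A T n x) \<longlonglongrightarrow> z"
    unfolding tendsto_iff_seminorms
  proof (intro allI impI)
    fix p
    assume p: "continuous_seminorm p"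
    obtain q where q: "continuous_seminorm q" and pq: "\<And>y n. p (mean A T n y) \<le> q y"
      using bounded p unfolding matrix_bounded_def by blast
    show "(\<lambda>n. p (mean A T n x - z)) \<longlonglongrightarrow> 0"
    proof (rule tendstoI)
      fix e :: real
      assume e: "0 < e"
      then obtain w where w: "q (x - z - (T w - w)) < e / 2"
        using approx[OF q, of "e / 2"] by auto
      have "\<forall>\<^sub>F n in sequentially. p (mean A T n (T w - w)) < e / 2"
        using e by (intro order_tendstoD(2)[OF seminorm_tendsto_zero[OF p right]]) simp
      then show "\<forall>\<^sub>F n in sequentially. dist (p (mean A T n x - z)) 0 < e"
      proof (rule eventually_mono)
        fix n
        assume n: "p (mean A T n (T w - w)) < e / 2"
        have "mean A T n x - z = mean A T n (x - z - (T w - w)) + mean A T n (T w - w)"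
          by (simp add: mean_diff[OF T] mean_fixed_point[where T = T and z = z, OF A fixed])
        then have "p (mean A T n x - z)
            \<le> p (mean A T n (x - z - (T w - w))) + p (mean A T n (T w - w))"
          by (simp only: seminorm_add[OF p])
        then have "p (mean A T n x - z) \<le> q (x - z - (T w - w)) + p (mean A T n (T w - w))"
          using pq[of n "x - z - (T w - w)"] by linarith
        then show "dist (p (mean A T n x - z)) 0 < e"
          using w n seminorm_nonneg[OF p] by (simp add: dist_real_def)
      qed
    qed
  qed
  with fixed show ?thesis
    by blast
qed

text \<open>The \<open>B\<close>-means are the \<open>C\<close>-means of the \<open>A\<close>-means. Since the rows of \<open>A\<close> and of \<open>B = C A\<close> sum to one,
  so do those of \<open>C\<close>, and Toeplitz' theorem applies to the differences from the limit, measured by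
  a seminorm.\<close>

lemma star_2C_mean_tendsto:
  assumes A: "probability_matrix A" and B: "probability_matrix B" and AB: "star_2C A B"
    and lim: "(\<lambda>n. mean A T n x) \<longlonglongrightarrow> z"
  shows "(\<lambda>n. mean B T n x) \<longlonglongrightarrow> z"
proof -
  obtain C H where C: "lower_triangular C" and CA: "matrix_product C A = B"
    and H: "\<And>n. (\<Sum>i. norm (C n i)) \<le> H" and cols: "\<And>i. (\<lambda>n. C n i) \<longlonglongrightarrow> 0"
    using AB by (auto simp: star_2C_def bdd_above_def)
  have B_eq: "B n k = (\<Sum>i\<le>n. C n i * A i k)" for n k
    using suminf_lower_triangular[OF C, of "\<lambda>c i. c * A i k"] by (simp add: CA[symmetric] matrix_product_def)
  have A_zero: "A i k = 0" if "i < k" for i k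
    using A that by (simp add: probability_matrix_def lower_triangular_def)
  \<comment> \<open>Summing the rows of \<open>A\<close> up to the common bound \<open>n\<close> makes the order of summation below
    interchangeable.\<close>
  have A_row: "(\<Sum>k\<le>n. A i k) = 1" if "i \<le> n" for i n
  proof -
    have "(\<Sum>k\<le>n. A i k) = (\<Sum>k\<le>i. A i k)"
      using that A_zero by (intro sum.mono_neutral_right) auto
    then show ?thesis
      using A by (simp add: probability_matrix_def)
  qed
  have A_mean: "(\<Sum>k\<le>n. scale (A i k) ((T ^^ k) x)) = mean A T i x" if "i \<le> n" for i n
    unfolding mean_def using that A_zero by (intro sum.mono_neutral_right) auto
  have C_row: "(\<Sum>i\<le>n. C n i) = 1" for n
  proof -
    have "1 = (\<Sum>k\<le>n. \<Sum>i\<le>n. C n i * A i k)"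
      using B by (simp add: probability_matrix_def B_eq)
    also have "\<dots> = (\<Sum>i\<le>n. C n i * (\<Sum>k\<le>n. A i k))"
      by (subst sum.swap) (simp add: sum_distrib_left)
    finally show ?thesis
      by (simp add: A_row)
  qed
  have B_mean: "mean B T n x = (\<Sum>i\<le>n. scale (C n i) (mean A T i x))" for n
  proof -
    have "mean B T n x = (\<Sum>k\<le>n. \<Sum>i\<le>n. scale (C n i) (scale (A i k) ((T ^^ k) x)))"
      by (simp add: mean_def B_eq scale_sum_left)
    also have "\<dots> = (\<Sum>i\<le>n. scale (C n i) (\<Sum>k\<le>n. scale (A i k) ((T ^^ k) x)))"
      by (subst sum.swap) (simp add: scale_sum_right)
    finally show ?thesis
      by (simp add: A_mean)
  qed
  show ?thesis
    unfolding tendsto_iff_seminorms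
  proof (intro allI impI)
    fix p
    assume p: "continuous_seminorm p"
    have lim0: "(\<lambda>n. \<Sum>i\<le>n. norm (C n i) * p (mean A T i x - z)) \<longlonglongrightarrow> 0"
    proof (rule toeplitz_null)
      show "(\<Sum>i\<le>n. norm (C n i)) \<le> H" for n
        using H[of n] suminf_lower_triangular[OF C, of "\<lambda>c i. norm c" n] by simp
      show "(\<lambda>n. norm (C n i)) \<longlonglongrightarrow> 0" for i
        using cols by (rule tendsto_norm_zero)
      show "(\<lambda>i. p (mean A T i x - z)) \<longlonglongrightarrow> 0"
        using lim p unfolding tendsto_iff_seminorms by blast
    qed simp
    have le: "p (mean B T n x - z) \<le> (\<Sum>i\<le>n. norm (C n i) * p (mean A T i x - z))" for n
    proof -
      have "mean B T n x - z = mean B T n x - scale (\<Sum>i\<le>n. C n i) z"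
        by (simp add: C_row)
      also have "\<dots> = (\<Sum>i\<le>n. scale (C n i) (mean A T i x - z))"
        by (simp add: B_mean scale_sum_left scale_right_diff_distrib sum_subtractf)
      finally show ?thesis
        using seminorm_sum[OF p, of "\<lambda>i. scale (C n i) (mean A T i x - z)" "{..n}"]
        by (simp add: seminorm_scale[OF p])
    qed
    from lim0 show "(\<lambda>n. p (mean B T n x - z)) \<longlonglongrightarrow> 0"
      by (rule Lim_null_comparison[rotated]) (simp add: seminorm_nonneg[OF p] le)
  qed
qed

text \<open>The bound \<open>p (mean A T n y) \<le> q y\<close> does not depend on \<open>n\<close> and passes to the limit, which gives
  continuity.\<close>

lemma operator_mean_limit:
  assumes T: "operator T" and bounded: "matrix_bounded A T"
    and lim: "\<And>x. (\<lambda>n. mean A T n x) \<longlonglongrightarrow> P x"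
  shows "operator P"
  unfolding operator_iff
proof (intro conjI allI)
  show add: "P (x + y) = P x + P y" for x y
    using LIMSEQ_unique[OF lim[of "x + y", unfolded mean_add[OF T]] tendsto_add[OF lim lim]] .
  show "P (scale c x) = scale c (P x)" for c x
    using LIMSEQ_unique[OF lim[of "scale c x", unfolded mean_scale[OF T]]
        tendsto_scale[OF tendsto_const lim]] .
  have diff: "P (x - y) = P x - P y" for x y
    using add[of "x - y" y] by simp
  show "continuous_on UNIV P"
    unfolding continuous_on_eq_continuous_at[OF open_UNIV]
  proof
    fix x :: 'a
    show "isCont P x"
      unfolding isCont_def tendsto_iff_seminorms
    proof (intro allI impI)
      fix p
      assume p: "continuous_seminorm p"
      obtain q where q: "continuous_seminorm q" and pq: "\<And>y n. p (mean A T n y) \<le> q y"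
        using bounded p unfolding matrix_bounded_def by blast
      have le: "p (P y) \<le> q y" for y
      proof (rule tendsto_upperbound)
        show "(\<lambda>n. p (mean A T n y)) \<longlonglongrightarrow> p (P y)"
          by (rule isCont_tendsto_compose[OF _ lim])
            (use seminorm_continuous[OF p] in \<open>simp add: continuous_on_eq_continuous_at\<close>)
      qed (simp_all add: pq)
      have "((\<lambda>y. y) \<longlongrightarrow> x) (at x)"
        by (rule tendsto_ident_at)
      then have "((\<lambda>y. q (y - x)) \<longlongrightarrow> 0) (at x)"
        using q unfolding tendsto_iff_seminorms by blast
      then show "((\<lambda>y. p (P y - P x)) \<longlongrightarrow> 0) (at x)"
        by (rule tendsto_sandwich[OF _ _ tendsto_const, rotated 2])
          (simp_all add: seminorm_nonneg[OF p] le diff[symmetric])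
    qed
  qed
qed

end

theorem theorem4p12:
  fixes A B :: "nat \<Rightarrow> nat \<Rightarrow> complex"
    and scale :: "complex \<Rightarrow> 'a::{topological_ab_group_add, t2_space} \<Rightarrow> 'a"
    and T :: "'a \<Rightarrow> 'a"
  assumes "probability_matrix A" and "probability_matrix B"
    and "star_2C A B"
    and "locally_convex_space scale"
    and "locally_convex_space.reflexive scale"
    and "locally_convex_space.operator scale T"
    and "locally_convex_space.matrix_bounded scale A T"
    and "\<And>x. (\<lambda>n. T (locally_convex_space.mean scale A T n x)
               - locally_convex_space.mean scale A T n x) \<longlonglongrightarrow> 0"
    and "\<And>x. (\<lambda>n. locally_convex_space.mean scale A T n (T x - x)) \<longlonglongrightarrow> 0"
  shows "locally_convex_space.matrix_ergodic scale B T"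
proof -
  interpret locally_convex_space scale
    by fact
  have "semi_reflexive"
    using assms(5) by (simp add: reflexive_def)
  then have "\<exists>z. (\<lambda>n. mean A T n x) \<longlonglongrightarrow> z" for x
    using mean_ergodic[OF assms(1) _ assms(6-9)] by blast
  then obtain P where P: "\<And>x. (\<lambda>n. mean A T n x) \<longlonglongrightarrow> P x"
    by metis
  have "operator P"
    by (rule operator_mean_limit[OF assms(6,7) P])
  moreover have "(\<lambda>n. mean B T n x) \<longlonglongrightarrow> P x" for x
    by (rule star_2C_mean_tendsto[OF assms(1-3) P])
  ultimately show ?thesis
    unfolding matrix_ergodic_def by blast
qed

end
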